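(* Let $n\ge 2$ and $k$ be positive integers and $w\in S_n$. Then $x_k(w)$ equals each of the following: (1) $k^{-(n-1)}$ times the number of partitions with at most $n-1$ parts, each part of size at most $k-cd(w)$, whose total is congruent to $-maj(w)$ mod $n$; (2) $k^{-(n-1)}$ times the number of partitions with at most $k-cd(w)$ parts, each part of size at most $n-1$, whose total is congruent to $-maj(w)$ mod $n$; (3) $k^{-(n-1)}\sum_{r\ge 0}$ (coefficient of $q^{rn}$ in $q^{maj(w)}\left[{k+n-cd(w)-1\atop n-1}\right]_q$); (4) $\frac{1}{nk^{n-1}}\sum_{d\mid n,\ d\mid k-cd(w)}\binom{(n+k-cd(w)-d)/d}{(k-cd(w))/d}C_d(-maj(w))$ if $k-cd(w)>0$; $k^{-(n-1)}$ if $k-cd(w)=0$ and $maj(w)\equiv 0 \bmod n$; and $0$ otherwise.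
   Context: For $w\in S_n$: $maj(w)=\sum_{1\le i\le n-1,\ w(i)>w(i+1)} i$; $cd(w)$ is the number of $i\in\{1,\dots,n-1\}$ with $w(i)>w(i+1)$, plus $1$ if $w(n)>w(1)$. The type $A_{n-1}$ affine $k$-shuffle coefficient $x_k(w)$ is $k^{-(n-1)}$ times the number of integer vectors $(v_1,\dots,v_n)$ with $v_1+\dots+v_n=0$, $v_1\ge v_2\ge\dots\ge v_n$, $v_1-v_n\le k$, $v_i>v_{i+1}$ whenever $w(i)>w(i+1)$ ($1\le i\le n-1$), and $v_1<v_n+k$ if $w(n)>w(1)$. $\left[{a\atop b}\right]_q=\frac{(q^a-1)\cdots(q-1)}{(q^b-1)\cdots(q-1)(q^{a-b}-1)\cdots(q-1)}$ is the $q$-binomial coefficient (zero if $a<b$ or $a<0$). $C_m(N)=\sum e^{2\pi i jN/m}$ is the Ramanujan sum over $1\le j\le m$ with $\gcd(j,m)=1$. Partitions are in the number-theoretic sense. *)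

theory Defs
  imports
    Complex_Main
    "HOL-Library.Multiset"
    "HOL-Library.FuncSet"
    "HOL-Combinatorics.Permutations"
    "HOL-Computational_Algebra.Polynomial"
    "HOL-Number_Theory.Cong"
begin

text \<open>
  An element of \<open>S_n\<close> is a function \<open>w\<close> with \<open>w permutes {1..n}\<close>.
\<close>

definition descent_set :: "nat \<Rightarrow> (nat \<Rightarrow> nat) \<Rightarrow> nat set" where
  "descent_set n w = {i \<in> {1..n - 1}. w i > w (i + 1)}"

definition maj :: "nat \<Rightarrow> (nat \<Rightarrow> nat) \<Rightarrow> nat" where
  "maj n w = \<Sum> (descent_set n w)"

definition cd :: "nat \<Rightarrow> (nat \<Rightarrow> nat) \<Rightarrow> nat" where
  "cd n w = card (descent_set n w) + (if w n > w 1 then 1 else 0)"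

text \<open>
  Integer vectors \<open>(v_1, \<dots>, v_n)\<close> are extensional functions on \<open>{1..n}\<close>, so that
  each vector is counted once.
\<close>

definition affine_shuffle_vectors :: "nat \<Rightarrow> nat \<Rightarrow> (nat \<Rightarrow> nat) \<Rightarrow> (nat \<Rightarrow> int) set" where
  "affine_shuffle_vectors n k w =
     {v \<in> {1..n} \<rightarrow>\<^sub>E (UNIV :: int set).
        (\<Sum>i = 1..n. v i) = 0 \<and>
        (\<forall>i \<in> {1..n - 1}. v i \<ge> v (i + 1)) \<and>
        v 1 - v n \<le> int k \<and>
        (\<forall>i \<in> {1..n - 1}. w i > w (i + 1) \<longrightarrow> v i > v (i + 1)) \<and>
        (w n > w 1 \<longrightarrow> v 1 < v n + int k)}"

definition affine_shuffle_coeff :: "nat \<Rightarrow> nat \<Rightarrow> (nat \<Rightarrow> nat) \<Rightarrow> real" where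
  "affine_shuffle_coeff n k w = real (card (affine_shuffle_vectors n k w)) / real k ^ (n - 1)"

lemma finite_affine_shuffle_vectors: "finite (affine_shuffle_vectors n k w)"
proof (cases "n = 0")
  case True
  then show ?thesis by (simp add: affine_shuffle_vectors_def)
next
  case False
  have "affine_shuffle_vectors n k w \<subseteq> {1..n} \<rightarrow>\<^sub>E {- int k..int k}"
  proof
    fix v assume v: "v \<in> affine_shuffle_vectors n k w"
    have desc: "v (i + 1) \<le> v i" if "i \<in> {1..n - 1}" for i
      using v that by (auto simp: affine_shuffle_vectors_def)
    have mono: "v j \<le> v i" if "1 \<le> i" "i \<le> j" "j \<le> n" for i j
      using that(2,3)
    proof (induction j rule: dec_induct)
      case (step m)
      have "v (m + 1) \<le> v m"
        using step.hyps step.prems that(1) desc[of m] by auto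
      then show ?case using step.IH step.prems by simp
    qed simp
    have sum0: "(\<Sum>i = 1..n. v i) = 0" and spread: "v 1 - v n \<le> int k"
      using v by (auto simp: affine_shuffle_vectors_def)
    have "v n \<le> 0"
    proof (rule ccontr)
      assume "\<not> v n \<le> 0"
      then have "(\<Sum>i = 1..n. v i) > 0"
        using False mono[of _ n] by (intro sum_pos) force+
      then show False using sum0 by simp
    qed
    moreover have "v 1 \<ge> 0"
    proof (rule ccontr)
      assume "\<not> v 1 \<ge> 0"
      then have "(\<Sum>i = 1..n. - v i) > 0"
        using False mono[of 1] by (intro sum_pos) force+
      then show False using sum0 by (simp add: sum_negf)
    qed
    ultimately have "v i \<in> {- int k..int k}" if "i \<in> {1..n}" for i
      using mono[of 1 i] mono[of i n] that spread by auto
    then show "v \<in> {1..n} \<rightarrow>\<^sub>E {- int k..int k}"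
      using v by (auto simp: affine_shuffle_vectors_def PiE_iff)
  qed
  then show ?thesis by (rule finite_subset) (simp add: finite_PiE)
qed

text \<open>
  A partition is a finite multiset of positive integers: its number of parts is \<open>size\<close> and
  its total is \<open>sum_mset\<close>. The empty partition (of \<open>0\<close>) has largest part \<open>0\<close>, so that
  no partition has all its parts bounded by a negative number.
\<close>

definition is_partition :: "nat multiset \<Rightarrow> bool" where
  "is_partition p \<longleftrightarrow> 0 \<notin># p"

definition largest_part :: "nat multiset \<Rightarrow> nat" where
  "largest_part p = Max (insert 0 (set_mset p))"

text \<open>
  The bounds are integers, because they are instantiated with the possibly negative number
  \<open>k - cd w\<close>.
\<close>

definition partitions_in_box :: "int \<Rightarrow> int \<Rightarrow> nat multiset set" where
  "partitions_in_box a b =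
     {p. is_partition p \<and> int (size p) \<le> a \<and> int (largest_part p) \<le> b}"

lemma finite_partitions_in_box: "finite (partitions_in_box a b)"
proof -
  have "partitions_in_box a b \<subseteq> mset ` {xs. set xs \<subseteq> {..nat b} \<and> length xs \<le> nat a}"
  proof
    fix p assume p: "p \<in> partitions_in_box a b"
    obtain xs where xs: "p = mset xs" by (metis ex_mset)
    have "x \<le> nat b" if "x \<in> set xs" for x
    proof -
      have "x \<le> largest_part p"
        using that by (auto simp: largest_part_def xs intro: Max_ge)
      moreover have "int (largest_part p) \<le> b"
        using p by (simp add: partitions_in_box_def)
      ultimately show ?thesis by linarith
    qed
    then show "p \<in> mset ` {xs. set xs \<subseteq> {..nat b} \<and> length xs \<le> nat a}"
      using p xs by (auto simp: partitions_in_box_def)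
  qed
  then show ?thesis
    by (rule finite_subset) (intro finite_imageI finite_lists_length_le, simp)
qed

text \<open>\<open>(q^a - 1) \<cdots> (q - 1)\<close>\<close>

definition q_prod :: "nat \<Rightarrow> real poly" where
  "q_prod a = (\<Prod>i = 1..a. monom 1 i - 1)"

text \<open>
  Here \<open>div\<close> is Euclidean division of polynomials; the division is exact by
  \<open>q_prod_dvd\<close> below. As \<open>b\<close> is a natural number, the case \<open>a < b\<close> includes \<open>a < 0\<close>.
\<close>

definition q_binomial :: "int \<Rightarrow> nat \<Rightarrow> real poly" where
  "q_binomial a b =
     (if a < int b then 0
      else q_prod (nat a) div (q_prod b * q_prod (nat a - b)))"

lemma q_prod_Suc: "q_prod (Suc a) = q_prod a * (monom 1 (Suc a) - 1)"
  by (simp add: q_prod_def)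

lemma q_prod_dvd: "b \<le> a \<Longrightarrow> q_prod b * q_prod (a - b) dvd q_prod a"
proof (induction a arbitrary: b)
  case 0
  then show ?case by (simp add: q_prod_def)
next
  case (Suc a)
  show ?case
  proof (cases "b = 0 \<or> b = Suc a")
    case True
    then show ?thesis by (auto simp: q_prod_def)
  next
    case False
    then obtain c where b: "b = Suc c" and ba: "b \<le> a"
      using Suc.prems by (cases b) auto
    have sub: "Suc a - b = Suc (a - b)" and subc: "a - c = Suc (a - b)"
      using b ba by simp_all
    have "monom 1 (Suc a) = monom 1 b * (monom 1 (Suc (a - b)) :: real poly)"
      using ba by (simp add: mult_monom)
    then have split: "q_prod (Suc a) =
        monom 1 b * (q_prod a * (monom 1 (Suc (a - b)) - 1)) + q_prod a * (monom 1 b - 1)"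
      by (simp add: q_prod_Suc algebra_simps)
    have "q_prod b * q_prod (Suc a - b) = (q_prod b * q_prod (a - b)) * (monom 1 (Suc (a - b)) - 1)"
      by (simp add: sub q_prod_Suc)
    then have 1: "q_prod b * q_prod (Suc a - b) dvd q_prod a * (monom 1 (Suc (a - b)) - 1)"
      using mult_dvd_mono[OF Suc.IH[OF ba] dvd_refl] by (simp only:)
    have "q_prod b * q_prod (Suc a - b) = (q_prod c * q_prod (a - c)) * (monom 1 b - 1)"
      unfolding sub subc unfolding b q_prod_Suc by (simp only: mult_ac)
    moreover have "q_prod c * q_prod (a - c) dvd q_prod a"
      using Suc.IH[of c] b ba by simp
    ultimately have 2: "q_prod b * q_prod (Suc a - b) dvd q_prod a * (monom 1 b - 1)"
      using mult_dvd_mono[OF _ dvd_refl] by (simp only:)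
    show ?thesis
      unfolding split by (rule dvd_add[OF dvd_mult[OF 1] 2])
  qed
qed

definition ramanujan_sum :: "nat \<Rightarrow> int \<Rightarrow> complex" where
  "ramanujan_sum m N =
     (\<Sum>j | 1 \<le> j \<and> j \<le> m \<and> coprime j m.
        exp (2 * of_real pi * \<i> * of_nat j * of_int N / of_nat m))"

end

theory Submission
  imports
    Defs
    "HOL-Computational_Algebra.Polynomial_FPS"
    "HOL-Number_Theory.Totient"
begin

text \<open>
  A shuffle vector \<open>v\<close> is determined by its excess steps \<open>u\<^sub>i = v\<^sub>i - v\<^sub>i\<^sub>+\<^sub>1 - [i is a descent]\<close>
  for \<open>1 \<le> i < n\<close>, which are natural numbers with sum at most \<open>k - cd w\<close>. By Abel summation
  \<open>v\<^sub>1 + \<dots> + v\<^sub>n = 0\<close> is solvable for \<open>v\<^sub>n\<close> exactly if \<open>\<Sum>i u\<^sub>i \<equiv> -maj w (mod n)\<close>, so reading \<open>u\<^sub>i\<close>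
  as the multiplicity of the part \<open>i\<close> gives (2). The generating function of the partitions in a box
  is the Gaussian binomial; its symmetry gives (1), and its coefficients give (3).
  For (4) the congruence is detected with the \<open>n\<close>-th roots of unity, grouped by their order \<open>d\<close>:
  at a primitive \<open>d\<close>-th root \<open>z\<close> the generating function of at most \<open>a\<close> parts of size at most \<open>n - 1\<close>
  is the coefficient of \<open>t\<^sup>a\<close> in \<open>1 / \<Prod>\<^sub>j\<^sub><\<^sub>n (1 - z\<^sup>j t) = 1 / (1 - t\<^sup>d)\<^sup>n\<^sup>/\<^sup>d\<close>.
\<close>

section \<open>Generating functions of partitions in a box\<close>

text \<open>The first bound stays an arbitrary integer, because it is instantiated with
  \<open>k - cd w\<close>, which may be negative.\<close>

lemma mem_partitions_in_box:
  "p \<in> partitions_in_box a (int b) \<longleftrightarrow> int (size p) \<le> a \<and> set_mset p \<subseteq> {1..b}"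
proof -
  have "is_partition p \<and> largest_part p \<le> b \<longleftrightarrow> (\<forall>x\<in>#p. x \<noteq> 0 \<and> x \<le> b)"
    by (auto simp: is_partition_def largest_part_def intro: gr0I)
  also have "\<dots> \<longleftrightarrow> set_mset p \<subseteq> {1..b}"
    by (auto simp: Suc_le_eq)
  finally show ?thesis
    by (auto simp: partitions_in_box_def)
qed

lemma partitions_in_box_negative:
  assumes "a < 0 \<or> b < 0"
  shows "partitions_in_box a b = {}"
  using assms by (auto simp: partitions_in_box_def)

lemma partitions_in_box_0_left [simp]: "partitions_in_box 0 (int b) = {{#}}"
  by (auto simp: mem_partitions_in_box simp del: of_nat_Suc)

lemma partitions_in_box_0_right [simp]: "partitions_in_box (int a) 0 = {{#}}"
proof -
  have "p \<in> partitions_in_box (int a) 0 \<longleftrightarrow> p \<in> {{#}}" for p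
    using mem_partitions_in_box[of p "int a" 0] by auto
  then show ?thesis by blast
qed

text \<open>Sort by whether the maximal size \<open>Suc b\<close> occurs as a part; if it does,
  removing one copy leaves room for one part fewer.\<close>

lemma partitions_in_box_Suc_Suc:
  "partitions_in_box (int (Suc a)) (int (Suc b)) =
     partitions_in_box (int (Suc a)) (int b) \<union>
     add_mset (Suc b) ` partitions_in_box (int a) (int (Suc b))" (is "?L = ?R")
proof (intro equalityI subsetI)
  fix p assume p: "p \<in> ?L"
  show "p \<in> ?R"
  proof (cases "Suc b \<in># p")
    case True
    then obtain q where q: "p = add_mset (Suc b) q" by (metis mset_add)
    then show ?thesis using p by (auto simp: mem_partitions_in_box simp del: of_nat_Suc)
  next
    case False
    then show ?thesis
      using p by (auto simp: mem_partitions_in_box subset_iff le_Suc_eq simp del: of_nat_Suc)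
  qed
next
  fix p assume p: "p \<in> ?R"
  have "{1..b} \<subseteq> {1..Suc b}" by auto
  with p show "p \<in> ?L" by (fastforce simp: mem_partitions_in_box simp del: of_nat_Suc)
qed

text \<open>The argument ranges over any commutative semiring, so that one recursion serves both the
  indeterminate \<open>monom 1 1\<close>, which yields the Gaussian binomials, and complex roots of
  unity.\<close>

definition box_gf :: "nat \<Rightarrow> nat \<Rightarrow> 'a \<Rightarrow> 'a :: comm_semiring_1" where
  "box_gf a b x = (\<Sum>p\<in>partitions_in_box (int a) (int b). x ^ sum_mset p)"

lemma box_gf_0 [simp]: "box_gf 0 b x = 1" "box_gf a 0 x = 1"
  by (simp_all add: box_gf_def)

text \<open>The q-Pascal rule: removing one part \<open>Suc b\<close> divides the weight by
  \<open>x ^ Suc b\<close>.\<close>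

lemma box_gf_Suc_Suc:
  "box_gf (Suc a) (Suc b) x = box_gf (Suc a) b x + x ^ Suc b * box_gf a (Suc b) x"
proof -
  let ?P = "partitions_in_box (int (Suc a)) (int b)"
  let ?Q = "partitions_in_box (int a) (int (Suc b))"
  have "box_gf (Suc a) (Suc b) x =
      box_gf (Suc a) b x + (\<Sum>p\<in>add_mset (Suc b) ` ?Q. x ^ sum_mset p)"
    unfolding box_gf_def partitions_in_box_Suc_Suc
    by (intro sum.union_disjoint finite_imageI finite_partitions_in_box)
      (auto simp: mem_partitions_in_box)
  also have "(\<Sum>p\<in>add_mset (Suc b) ` ?Q. x ^ sum_mset p) = x ^ Suc b * box_gf a (Suc b) x"
    by (subst sum.reindex) (simp_all add: inj_on_def box_gf_def sum_distrib_left power_add mult.assoc)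
  finally show ?thesis .
qed

text \<open>The product formula for Gaussian binomials with denominators cleared, by induction along
  the q-Pascal rule.\<close>

lemma box_gf_q_prod:
  "box_gf a b (monom 1 1) * (q_prod a * q_prod b) = q_prod (a + b)"
proof (induction "a + b" arbitrary: a b)
  case 0
  then show ?case by (simp add: q_prod_def)
next
  case (Suc s)
  show ?case
  proof (cases "a = 0 \<or> b = 0")
    case True
    then show ?thesis by (auto simp: q_prod_def)
  next
    case False
    then obtain a' b' where ab: "a = Suc a'" "b = Suc b'"
      by (metis not0_implies_Suc)
    let ?X = "monom 1 1 :: real poly"
    have 1: "box_gf a b' ?X * (q_prod a * q_prod b') = q_prod (a' + b)"
      using Suc.hyps(1)[of a b'] Suc.hyps(2) ab by simp
    have 2: "box_gf a' b ?X * (q_prod a' * q_prod b) = q_prod (a' + b)"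
      using Suc.hyps(1)[of a' b] Suc.hyps(2) ab by simp
    have q: "q_prod a = q_prod a' * (?X ^ a - 1)" "q_prod b = q_prod b' * (?X ^ b - 1)"
      by (simp_all only: ab q_prod_Suc monom_power power_one mult_1)
    have G: "box_gf a b ?X = box_gf a b' ?X + ?X ^ b * box_gf a' b ?X"
      unfolding ab by (rule box_gf_Suc_Suc)
    have "box_gf a b ?X * (q_prod a * q_prod b) =
        box_gf a b' ?X * (q_prod a * q_prod b') * (?X ^ b - 1) +
        ?X ^ b * (box_gf a' b ?X * (q_prod a' * q_prod b)) * (?X ^ a - 1)"
      unfolding G q by (simp add: algebra_simps)
    \<comment> \<open>The two terms recombine by
      \<open>(x ^ b - 1) + x ^ b * (x ^ a - 1) = x ^ (a + b) - 1\<close>.\<close>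
    also have "\<dots> = q_prod (a' + b) * (?X ^ (a + b) - 1)"
      unfolding 1 2 by (simp add: power_add algebra_simps)
    also have "\<dots> = q_prod (a + b)"
    proof -
      have "a + b = Suc (a' + b)" by (simp add: ab)
      then show ?thesis by (simp only: q_prod_Suc monom_power power_one mult_1)
    qed
    finally show ?thesis .
  qed
qed

lemma q_prod_nonzero: "q_prod a \<noteq> 0"
proof -
  have "monom 1 i \<noteq> (1 :: real poly)" if "i \<ge> 1" for i
    using that degree_monom_eq[of "1 :: real" i] by auto
  then show ?thesis by (simp add: q_prod_def)
qed

lemma q_binomial_eq_box_gf: "q_binomial (int (a + b)) b = box_gf a b (monom 1 1)"
proof -
  have "q_prod (a + b) = box_gf a b (monom 1 1) * (q_prod b * q_prod a)"
    using box_gf_q_prod[of a b] by (simp add: mult_ac)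
  moreover have "nat (int (a + b)) = a + b"
    by (rule nat_int)
  ultimately show ?thesis
    by (simp add: q_binomial_def q_prod_nonzero del: of_nat_add)
qed

section \<open>Symmetry of the box and extraction of coefficients\<close>

lemma box_gf_commute: "box_gf a b (monom 1 1 :: real poly) = box_gf b a (monom 1 1)"
proof -
  \<comment> \<open>The product formula is symmetric in \<open>a\<close> and \<open>b\<close>;
    cancelling the non-zero q-products takes the place of conjugating Ferrers diagrams.\<close>
  have "box_gf a b (monom 1 1) * (q_prod a * q_prod b) = box_gf b a (monom 1 1) * (q_prod a * q_prod b)"
    using box_gf_q_prod[of a b] box_gf_q_prod[of b a] by (simp add: mult_ac add_ac)
  then show ?thesis by (simp add: q_prod_nonzero)
qed

lemma coeff_box_gf:
  "coeff (box_gf a b (monom 1 1)) s =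
     of_nat (card {p \<in> partitions_in_box (int a) (int b). sum_mset p = s})"
proof -
  have "coeff (box_gf a b (monom 1 1)) s =
      (\<Sum>p\<in>partitions_in_box (int a) (int b). if sum_mset p = s then 1 else 0)"
    by (simp add: box_gf_def coeff_sum monom_power)
  then show ?thesis
    by (simp add: finite_partitions_in_box flip: sum.inter_filter)
qed

lemma card_partitions_in_box_sum_commute:
  "card {p \<in> partitions_in_box a b. sum_mset p = s} =
   card {p \<in> partitions_in_box b a. sum_mset p = s}"
proof (cases "a < 0 \<or> b < 0")
  case True
  then have "partitions_in_box a b = {}" "partitions_in_box b a = {}"
    using partitions_in_box_negative by blast+
  then show ?thesis by simp
next
  case False
  then obtain a' b' where "a = int a'" "b = int b'"
    by (metis nonneg_int_cases not_less)
  then show ?thesis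
    using coeff_box_gf[where 'a = real, of a' b' s] coeff_box_gf[where 'a = real, of b' a' s]
    by (metis box_gf_commute of_nat_eq_iff)
qed

lemma card_eq_sum_card_fibres:
  assumes "finite A"
  shows "card {p \<in> A. P (f p)} = (\<Sum>s\<in>{s \<in> f ` A. P s}. card {p \<in> A. f p = s})"
proof -
  have "card {p \<in> A. P (f p)} = card (\<Union>s\<in>{s \<in> f ` A. P s}. {p \<in> A. f p = s})"
    by (rule arg_cong[of _ _ card]) auto
  also have "\<dots> = (\<Sum>s\<in>{s \<in> f ` A. P s}. card {p \<in> A. f p = s})"
    using assms by (intro card_UN_disjoint) auto
  finally show ?thesis .
qed

text \<open>Symmetry for each single total extends to any condition on totals by summing over the
  fibres of \<open>sum_mset\<close>.\<close>

lemma card_partitions_in_box_commute: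
  "card {p \<in> partitions_in_box a b. P (sum_mset p)} =
   card {p \<in> partitions_in_box b a. P (sum_mset p)}"
proof -
  define S where "S a b = {s \<in> sum_mset ` partitions_in_box a b. P s}" for a b
  \<comment> \<open>A total occurs exactly if its fibre has non-zero cardinality, so the index sets
    of the two fibre sums agree as well.\<close>
  have S: "s \<in> S a b \<longleftrightarrow> P s \<and> card {p \<in> partitions_in_box a b. sum_mset p = s} \<noteq> 0" for s a b
    by (auto simp: S_def finite_partitions_in_box)
  have "S a b = S b a"
    unfolding set_eq_iff S card_partitions_in_box_sum_commute[of a b] by simp
  then show ?thesis
    unfolding card_eq_sum_card_fibres[OF finite_partitions_in_box] S_def[symmetric]
    by (simp add: card_partitions_in_box_sum_commute[of a b])
qed

text \<open>Each partition \<open>p\<close> contributes a monomial of degree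
  \<open>e + sum_mset p\<close>, which is met by exactly one \<open>r\<close> or by none, so the
  series reduces to a finite count.\<close>

lemma suminf_coeff_box_gf:
  assumes "n > 0"
  shows "(\<Sum>r. coeff (monom 1 e * box_gf a b (monom 1 1)) (r * n)) =
    real (card {p \<in> partitions_in_box (int a) (int b). n dvd e + sum_mset p})"
proof -
  let ?B = "partitions_in_box (int a) (int b)"
  have "coeff (monom 1 e * box_gf a b (monom 1 1)) (r * n) =
      (\<Sum>p\<in>?B. if r * n = e + sum_mset p then 1 else (0 :: real))" for r
    unfolding box_gf_def sum_distrib_left coeff_sum monom_power mult_monom
    by (intro sum.cong) auto
  moreover have "(\<lambda>r. if r * n = e + sum_mset p then 1 else (0 :: real)) sums
      (if n dvd e + sum_mset p then 1 else 0)" for p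
  proof (cases "n dvd e + sum_mset p")
    case True
    then obtain c where "e + sum_mset p = c * n" by (metis dvdE mult.commute)
    then show ?thesis
      using True assms sums_If_finite_set[of "{c}" "\<lambda>_. 1 :: real"] by simp
  next
    case False
    then have "r * n \<noteq> e + sum_mset p" for r by (metis dvd_triv_right)
    then show ?thesis using False by simp
  qed
  ultimately have "(\<lambda>r. coeff (monom 1 e * box_gf a b (monom 1 1)) (r * n)) sums
      (\<Sum>p\<in>?B. if n dvd e + sum_mset p then 1 else (0 :: real))"
    by (simp only: sums_sum)
  then show ?thesis
    by (simp add: sums_iff finite_partitions_in_box flip: sum.inter_filter)
qed

section \<open>Shuffle vectors as partitions\<close>

text \<open>With \<open>f\<close> constantly 1 this computes the size from the multiplicities, with
  the identity the total.\<close>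

lemma sum_mset_image_eq_sum_count:
  fixes f :: "'b \<Rightarrow> 'a :: comm_semiring_1"
  assumes "finite A" "set_mset p \<subseteq> A"
  shows "sum_mset (image_mset f p) = (\<Sum>j\<in>A. f j * of_nat (count p j))"
  using assms(2)
proof (induction p)
  case (add x p)
  have "(\<Sum>j\<in>A. f j * of_nat (count (add_mset x p) j)) =
      (\<Sum>j\<in>A. (if j = x then f j else 0) + f j * of_nat (count p j))"
    by (intro sum.cong) (auto simp: algebra_simps)
  then show ?case using add assms(1) by (simp add: sum.distrib)
qed simp

text \<open>Abel summation: each step is weighted by its position, so unit steps at the descents
  contribute exactly \<open>maj\<close>.\<close>

lemma sum_eq_weighted_differences:
  fixes v :: "nat \<Rightarrow> int"
  shows "(\<Sum>i = 1..Suc m. v i) =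
    int (Suc m) * v (Suc m) + (\<Sum>i = 1..m. int i * (v i - v (Suc i)))"
  by (induction m) (simp_all add: algebra_simps)

text \<open>Telescoping; the case \<open>i = Suc m\<close> is the empty sum and serves the last
  coordinate.\<close>

lemma sum_consecutive_differences:
  fixes v :: "nat \<Rightarrow> int"
  assumes "i \<le> Suc m"
  shows "(\<Sum>j = i..m. v j - v (Suc j)) = v i - v (Suc m)"
  using sum_Suc_diff[OF assms, of "\<lambda>j. - v j"] by (simp add: algebra_simps)

text \<open>An explicit bijection: \<open>F\<close> turns excess steps into multiplicities,
  \<open>G\<close> rebuilds the vector from its last coordinate.\<close>

lemma card_affine_shuffle_vectors:
  assumes "n \<ge> 1"
  shows "card (affine_shuffle_vectors n k w) =
    card {p \<in> partitions_in_box (int k - int (cd n w)) (int (n - 1)).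
            [int (sum_mset p) = - int (maj n w)] (mod int n)}" (is "_ = card ?P")
proof -
  obtain m where n: "n = Suc m" using assms by (cases n) auto
  \<comment> \<open>The least admissible size of the \<open>i\<close>-th step.\<close>
  define \<delta> :: "nat \<Rightarrow> int" where "\<delta> i = (if w i > w (Suc i) then 1 else 0)" for i
  define V where "V = affine_shuffle_vectors n k w"
  \<comment> \<open>The wrap-around term of \<open>cd\<close>: over the integers, strictness in
    \<open>v 1 < v n + k\<close> lowers the bound on \<open>v 1 - v n\<close> by one.\<close>
  define l :: int where "l = (if w n > w 1 then 1 else 0)"
  define F :: "(nat \<Rightarrow> int) \<Rightarrow> nat multiset" where
    "F v = (\<Sum>i = 1..m. replicate_mset (nat (v i - v (Suc i) - \<delta> i)) i)" for v
  \<comment> \<open>The last coordinate, solved from \<open>n * v n + maj + total = 0\<close>; the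
    division is exact under the congruence.\<close>
  define c where "c p = - ((int (maj n w) + int (sum_mset p)) div int n)" for p
  \<comment> \<open>At \<open>i = n\<close> the inner sum is empty, which leaves
    \<open>c p\<close>.\<close>
  define G :: "nat multiset \<Rightarrow> nat \<Rightarrow> int" where
    "G p = (\<lambda>i\<in>{1..n}. c p + (\<Sum>j = i..m. int (count p j) + \<delta> j))" for p
  have maj: "int (maj n w) = (\<Sum>i = 1..m. int i * \<delta> i)"
  proof -
    have "(\<Sum>i = 1..m. int i * \<delta> i) = (\<Sum>i = 1..m. if w i > w (Suc i) then int i else 0)"
      by (intro sum.cong) (auto simp: \<delta>_def)
    then show ?thesis
      by (simp add: maj_def descent_set_def n flip: sum.inter_filter)
  qed
  have cd: "int (cd n w) = (\<Sum>i = 1..m. \<delta> i) + l"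
    by (simp add: cd_def descent_set_def n \<delta>_def l_def flip: sum.inter_filter)
  have V: "v \<in> V \<longleftrightarrow> v \<in> extensional {1..n} \<and> (\<Sum>i = 1..n. v i) = 0 \<and>
      (\<forall>i\<in>{1..m}. \<delta> i \<le> v i - v (Suc i)) \<and> v 1 - v n \<le> int k - l" for v
  proof -
    have step: "\<delta> i \<le> v i - v (Suc i) \<longleftrightarrow> v i \<ge> v (Suc i) \<and> (w i > w (Suc i) \<longrightarrow> v i > v (Suc i))" for i
      by (auto simp: \<delta>_def)
    have spread: "v 1 - v n \<le> int k - l \<longleftrightarrow> v 1 - v n \<le> int k \<and> (w n > w 1 \<longrightarrow> v 1 < v n + int k)"
      by (auto simp: l_def)
    show ?thesis
      unfolding V_def affine_shuffle_vectors_def step spread by (simp add: n PiE_def ball_conj_distrib) argo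
  qed
  have size: "int (size p) = (\<Sum>j = 1..m. int (count p j))"
    and total: "int (sum_mset p) = (\<Sum>j = 1..m. int j * int (count p j))"
    if "set_mset p \<subseteq> {1..m}" for p
    using sum_mset_image_eq_sum_count[OF _ that, of "\<lambda>_. 1 :: nat"]
      sum_mset_image_eq_sum_count[OF _ that, of "\<lambda>j. j"] by simp_all
  have P: "p \<in> ?P \<longleftrightarrow> int (size p) \<le> int k - int (cd n w) \<and> set_mset p \<subseteq> {1..m} \<and>
      int n dvd int (maj n w) + int (sum_mset p)" for p
    by (simp add: mem_partitions_in_box n cong_iff_dvd_diff add.commute)
  have count_F: "count (F v) j = (if j \<in> {1..m} then nat (v j - v (Suc j) - \<delta> j) else 0)" for v j
    by (simp add: F_def count_sum)
  have set_F: "set_mset (F v) \<subseteq> {1..m}" for v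
    using count_F[of v] by (auto simp: subset_iff set_mset_def split: if_splits)
  \<comment> \<open>Weight 1 will give the size of \<open>F v\<close>, weight \<open>int\<close> its
    total. Membership in \<open>V\<close> makes the excess steps non-negative, so \<open>nat\<close>
    loses nothing.\<close>
  have weighted_F: "(\<Sum>j = 1..m. g j * int (count (F v) j)) =
      (\<Sum>j = 1..m. g j * (v j - v (Suc j))) - (\<Sum>j = 1..m. g j * \<delta> j)" if "v \<in> V" for v g
  proof -
    have "(\<Sum>j = 1..m. g j * int (count (F v) j)) =
        (\<Sum>j = 1..m. g j * (v j - v (Suc j)) - g j * \<delta> j)"
      using that by (intro sum.cong) (auto simp: V count_F algebra_simps)
    then show ?thesis by (simp add: sum_subtractf)
  qed
  \<comment> \<open>As the coordinates sum to zero, this identity yields the congruence and also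
    lets \<open>c\<close> recover \<open>v n\<close> from \<open>F v\<close>.\<close>
  have total_F: "int (maj n w) + int (sum_mset (F v)) = - (int n * v n)" if "v \<in> V" for v
  proof -
    have "(\<Sum>i = 1..n. v i) = 0" using that V by blast
    then have "(\<Sum>i = 1..m. int i * (v i - v (Suc i))) = - (int n * v n)"
      using sum_eq_weighted_differences[of v m] unfolding n by linarith
    then show ?thesis
      using weighted_F[OF that, of int] total[OF set_F[of v]] maj by linarith
  qed
  have F_in: "F v \<in> ?P" if v: "v \<in> V" for v
  proof -
    \<comment> \<open>The excess steps telescope up to the number of descents; together with
      \<open>l\<close> these make up \<open>cd\<close>, so the bound on the spread becomes the bound
      on the size.\<close>
    have "int (size (F v)) = v 1 - v n - (\<Sum>j = 1..m. \<delta> j)"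
      using weighted_F[OF v, of "\<lambda>_. 1"] size[OF set_F[of v]]
        sum_consecutive_differences[of 1 m v] by (simp add: n)
    then show ?thesis
      unfolding P using v total_F[OF v] set_F[of v] by (simp add: V cd)
  qed
  have G_diff: "G p i - G p (Suc i) = int (count p i) + \<delta> i" if "i \<in> {1..m}" for p i
    using that by (simp add: G_def n sum.atLeast_Suc_atMost)
  have G_in: "G p \<in> V" if p: "p \<in> ?P" for p
  proof -
    have sp: "set_mset p \<subseteq> {1..m}" using p P by blast
    have "(\<Sum>i = 1..m. int i * (G p i - G p (Suc i))) = int (maj n w) + int (sum_mset p)"
      unfolding total[OF sp] maj sum.distrib[symmetric]
      by (intro sum.cong) (simp_all add: G_diff distrib_left)
    moreover have "G p (Suc m) = c p" by (simp add: G_def n)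
    ultimately have "(\<Sum>i = 1..n. G p i) = int n * c p + (int (maj n w) + int (sum_mset p))"
      using sum_eq_weighted_differences[of "G p" m] unfolding n by (simp only:)
    also have "\<dots> = 0" using p unfolding P c_def by auto
    finally have "(\<Sum>i = 1..n. G p i) = 0" .
    moreover have "G p 1 - G p n = int (size p) + (\<Sum>j = 1..m. \<delta> j)"
      by (simp add: G_def n size[OF sp] sum.distrib)
    moreover have "int (size p) \<le> int k - ((\<Sum>j = 1..m. \<delta> j) + l)"
      using p P unfolding cd[symmetric] by blast
    moreover have "G p \<in> extensional {1..n}"
      by (simp add: G_def)
    ultimately show ?thesis
      unfolding V by (simp add: G_diff)
  qed
  have "G (F v) = v" if v: "v \<in> V" for v
  proof (rule extensionalityI[of _ "{1..n}"])
    fix i assume i: "i \<in> {1..n}"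
    have "int n \<noteq> 0" by (simp add: n)
    then have "c (F v) = v n"
      unfolding c_def total_F[OF v] mult_minus_right[symmetric]
      by (simp only: nonzero_mult_div_cancel_left minus_minus simp_thms)
    moreover have "(\<Sum>j = i..m. int (count (F v) j) + \<delta> j) = (\<Sum>j = i..m. v j - v (Suc j))"
      using v i by (intro sum.cong) (auto simp: count_F V)
    ultimately show "G (F v) i = v i"
      using i sum_consecutive_differences[of i m v] by (simp add: G_def n)
  qed (use v V in \<open>auto simp: G_def\<close>)
  moreover have "F (G p) = p" if p: "p \<in> ?P" for p
  proof (rule multiset_eqI)
    fix j
    have "count p j = 0" if "j \<notin> {1..m}" using p that P by (meson not_in_iff subsetD)
    then show "count (F (G p)) j = count p j" by (simp add: count_F G_diff)
  qed
  ultimately have "bij_betw F V ?P"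
    using F_in G_in by (intro bij_betw_byWitness[of _ G]) blast+
  then show ?thesis unfolding V_def by (rule bij_betw_same_card)
qed

section \<open>Roots of unity\<close>

text \<open>The integer exponent admits negative powers, and reducing \<open>N / n\<close> to lowest
  terms becomes arithmetic on the two arguments.\<close>

definition unity_root :: "nat \<Rightarrow> int \<Rightarrow> complex" where
  "unity_root n N = cis (2 * pi * real_of_int N / real n)"

lemma unity_root_add: "unity_root n (M + N) = unity_root n M * unity_root n N"
  by (simp add: unity_root_def cis_mult add_divide_distrib distrib_left)

lemma unity_root_power: "unity_root n N ^ s = unity_root n (int s * N)"
  by (simp add: unity_root_def Complex.DeMoivre mult_ac)

lemma unity_root_cancel:
  assumes "c > 0"
  shows "unity_root (d * c) (N * int c) = unity_root d N"
  using assms by (simp add: unity_root_def mult.assoc)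

lemma unity_root_eq_1_iff:
  assumes "n > 0"
  shows "unity_root n N = 1 \<longleftrightarrow> int n dvd N"
proof
  assume "unity_root n N = 1"
  then have "cos (2 * pi * real_of_int N / real n) = 1"
    by (simp add: unity_root_def cis.code complex_eq_iff)
  then obtain c :: int where "2 * pi * real_of_int N / real n = of_int c * 2 * pi"
    by (auto simp: cos_one_2pi_int)
  then have "real_of_int N = of_int (c * int n)"
    using assms by (simp add: field_simps)
  then show "int n dvd N"
    by (metis dvd_triv_right of_int_eq_iff)
next
  assume "int n dvd N"
  then obtain c where "N = int n * c" ..
  then have "2 * pi * real_of_int N / real n = 2 * pi * real_of_int c"
    using assms by simp
  then show "unity_root n N = 1"
    by (simp only: unity_root_def cis_multiple_2pi Ints_of_int)
qed

lemma sum_unity_root: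
  assumes "n > 0"
  shows "(\<Sum>j\<in>{0<..n}. unity_root n (int j * N)) = (if int n dvd N then of_nat n else 0)"
proof -
  let ?z = "unity_root n N"
  have zn: "?z ^ n = 1"
    using assms by (simp add: unity_root_power unity_root_eq_1_iff)
  have "(\<Sum>j\<in>{0<..n}. unity_root n (int j * N)) = (\<Sum>j\<in>{0<..n}. ?z ^ j)"
    by (simp add: unity_root_power)
  also have "\<dots> = (\<Sum>j<n. ?z ^ Suc j)"
    by (rule sum.reindex_bij_witness[of _ Suc "\<lambda>j. j - 1"]) auto
  \<comment> \<open>Shifting the range only costs a factor \<open>?z\<close>: the sum vanishes for
    \<open>?z \<noteq> 1\<close> since \<open>?z ^ n = 1\<close>, and has \<open>n\<close> terms 1
    for \<open>?z = 1\<close>.\<close>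
  also have "\<dots> = ?z * (\<Sum>j<n. ?z ^ j)"
    by (simp add: sum_distrib_left)
  also have "\<dots> = (if int n dvd N then of_nat n else 0)"
    using geometric_sum[of ?z n] unity_root_eq_1_iff[OF assms, of N] zn by auto
  finally show ?thesis .
qed

lemma ramanujan_sum_eq: "ramanujan_sum d N = (\<Sum>j\<in>totatives d. unity_root d (int j * N))"
  unfolding ramanujan_sum_def
  by (rule sum.cong)
    (auto simp: totatives_def unity_root_def cis_conv_exp Suc_le_eq mult_ac)

text \<open>Each fraction \<open>j / n\<close> is brought to lowest terms. The argument of
  \<open>f\<close> is the whole map from exponents to roots, so that a summand may use several
  powers of the same root.\<close>

lemma sum_unity_root_by_order:
  assumes "n > 0"
  shows "(\<Sum>j\<in>{0<..n}. f (\<lambda>N. unity_root n (int j * N))) =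
    (\<Sum>d | d dvd n. \<Sum>j\<in>totatives d. f (\<lambda>N. unity_root d (int j * N)))"
proof -
  have "(\<Sum>j\<in>{0<..n}. f (\<lambda>N. unity_root n (int j * N))) =
      (\<Sum>c | c dvd n. \<Sum>j | j \<in> {0<..n} \<and> gcd j n = c. f (\<lambda>N. unity_root n (int j * N)))"
    using assms by (intro sum.group[symmetric]) auto
  \<comment> \<open>The indices with gcd \<open>c\<close> are the multiples by \<open>c\<close> of
    the totatives of \<open>n div c\<close>.\<close>
  also have "\<dots> = (\<Sum>c | c dvd n. \<Sum>j\<in>totatives (n div c). f (\<lambda>N. unity_root (n div c) (int j * N)))"
  proof (rule sum.cong[OF refl])
    fix c assume "c \<in> {c. c dvd n}"
    then have c: "c dvd n" by simp
    then have "c > 0" using assms by (auto intro: gr0I)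
    have root: "unity_root n (int (j * c) * N) = unity_root (n div c) (int j * N)" for j N
    proof -
      have "int (j * c) * N = int j * N * int c" by simp
      then show ?thesis
        using unity_root_cancel[OF \<open>c > 0\<close>, of "n div c" "int j * N"] c
        by (simp only: dvd_div_mult_self)
    qed
    show "(\<Sum>j | j \<in> {0<..n} \<and> gcd j n = c. f (\<lambda>N. unity_root n (int j * N))) =
        (\<Sum>j\<in>totatives (n div c). f (\<lambda>N. unity_root (n div c) (int j * N)))"
      unfolding root[symmetric]
      by (rule sum.reindex_bij_betw[OF bij_betw_totatives_gcd_eq[OF c assms], symmetric])
  qed
  also have "\<dots> = (\<Sum>d | d dvd n. \<Sum>j\<in>totatives d. f (\<lambda>N. unity_root d (int j * N)))"
    by (rule sum.reindex_bij_witness[where i = "\<lambda>d. n div d" and j = "\<lambda>c. n div c"])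
      (use assms in \<open>auto elim: dvdE\<close>)
  finally show ?thesis .
qed

section \<open>The denominator at a primitive root and its reciprocal series\<close>

lemma prod_one_minus_root_powers:
  fixes z :: complex
  assumes "d > 0" and z: "\<And>i. z ^ i = 1 \<longleftrightarrow> d dvd i"
  shows "(\<Prod>j<d. [:1, - (z ^ j):]) = 1 - monom 1 d" (is "?p = ?q")
proof -
  have zd: "z ^ d = 1" using z by simp
  then have z0: "z \<noteq> 0" using assms(1) by (auto simp: power_0_left)
  have inj: "inj_on (\<lambda>i. z ^ i) {..<d}"
  proof (rule linorder_inj_onI)
    fix i j assume ij: "i < j" "j \<in> {..<d}"
    show "z ^ i \<noteq> z ^ j"
    proof
      assume "z ^ i = z ^ j"
      then have "z ^ (j - i) = 1"
        using ij z0 by (simp add: power_diff)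
      then show False using ij by (auto simp: z dest: dvd_imp_le)
    qed
  qed auto
  \<comment> \<open>Both sides have degree at most \<open>d\<close>, so agreement at these
    \<open>d + 1\<close> distinct points suffices; 0 fixes the normalisation.\<close>
  let ?A = "insert 0 ((\<lambda>i. z ^ i) ` {..<d})"
  show ?thesis
  proof (rule poly_eqI_degree)
    fix x assume "x \<in> ?A"
    then consider "x = 0" | i where "i < d" "x = z ^ i" by auto
    then show "poly ?p x = poly ?q x"
    proof cases
      case 1
      then show ?thesis using assms(1) by (simp add: poly_prod poly_monom power_0_left)
    next
      case 2
      \<comment> \<open>\<open>z ^ j\<close> is the inverse of \<open>z ^ i\<close>, so the factor
        with index \<open>j\<close> vanishes at \<open>z ^ i\<close>; the \<open>mod\<close> covers
        \<open>i = 0\<close>.\<close>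
      define j where "j = (d - i) mod d"
      have "d dvd i + j"
        using 2(1) unfolding j_def by (cases "i = 0") auto
      then have "z ^ i * z ^ j = 1" by (simp add: z flip: power_add)
      moreover have "j < d" using assms(1) by (simp add: j_def)
      ultimately have "poly ?p x = 0" using 2 by (auto simp: poly_prod)
      moreover have "poly ?q x = 0"
        using 2 zd by (simp add: poly_monom flip: power_mult) (simp add: mult.commute power_mult)
      ultimately show ?thesis by simp
    qed
  next
    have card: "card ?A = Suc d" using z0 by (subst card_insert_disjoint) (auto simp: card_image[OF inj])
    have "degree ?p \<le> (\<Sum>j<d. degree [:1, - (z ^ j):])"
      using degree_prod_sum_le[of "{..<d}" "\<lambda>j. [:1, - (z ^ j):]"] by (simp only: o_def finite_lessThan)
    also have "\<dots> \<le> d"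
      using sum_bounded_above[of "{..<d}" "\<lambda>j. degree [:1, - (z ^ j):]" 1] by simp
    finally show "card ?A > degree ?p" using card by simp
    show "card ?A > degree ?q"
      using card degree_diff_le[of "1 :: complex poly" d "monom 1 d"] by (simp add: degree_monom_le)
  qed
qed

lemma prod_periodic:
  assumes "\<And>j. f (j + d) = f j"
  shows "(\<Prod>j<d * c. f j) = (\<Prod>j<d. f j :: 'a :: comm_monoid_mult) ^ c"
proof (induction c)
  case (Suc c)
  have f: "f (j + d * c) = f j" for j
  proof (induction c)
    case (Suc c)
    then show ?case using assms[of "j + d * c"] by (simp add: ac_simps)
  qed simp
  have "(\<Prod>j<d * c + e. f j) = (\<Prod>j<d * c. f j) * (\<Prod>j<e. f (j + d * c))" for e
    by (induction e) (simp_all add: add.commute mult.assoc)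
  from this[of d] show ?case
    using Suc unfolding f by (simp add: ac_simps)
qed simp

lemma fps_mult_one_minus_X_power_nth:
  fixes F :: "'a :: comm_ring_1 fps"
  shows "fps_nth (F * (1 - fps_X ^ d)) m = fps_nth F m - (if m < d then 0 else fps_nth F (m - d))"
  by (simp add: right_diff_distrib fps_X_power_mult_right_nth)

text \<open>The binomial series of \<open>1 / (1 - X^d)^c\<close>; multiplying by a single factor
  \<open>1 - X^d\<close> is Pascal's rule.\<close>

lemma multichoose_fps:
  assumes "d > 0"
  shows "Abs_fps (\<lambda>m. if d dvd m then of_nat ((c + m div d - 1) choose (m div d)) else 0) *
    (1 - fps_X ^ d) ^ c = (1 :: 'a :: comm_ring_1 fps)"
proof (induction c)
  case 0
  \<comment> \<open>For \<open>c = 0\<close> truncated subtraction gives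
    \<open>0 choose 0 = 1\<close> at index 0 and \<open>(e - 1) choose e = 0\<close> at
    \<open>d * e\<close> with \<open>e > 0\<close>, hence the series 1.\<close>
  show ?case
    using assms by (intro fps_ext) (auto simp: binomial_eq_0 elim!: dvdE)
next
  case (Suc c)
  define B :: "nat \<Rightarrow> 'a fps" where
    "B c = Abs_fps (\<lambda>m. if d dvd m then of_nat ((c + m div d - 1) choose (m div d)) else 0)" for c
  have B_mult: "fps_nth (B c) (d * e) = of_nat ((c + e - 1) choose e)" for c e
    using assms by (simp add: B_def)
  have B_other: "fps_nth (B c) m = 0" if "\<not> d dvd m" for c m
    using that by (simp add: B_def)
  have "fps_nth (B (Suc c) * (1 - fps_X ^ d)) m = fps_nth (B c) m" for m
  proof (cases "d dvd m")
    case True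
    then obtain e where m: "m = d * e" ..
    show ?thesis
    proof (cases e)
      case 0
      then show ?thesis
        using assms B_mult[of _ 0] by (simp add: fps_mult_one_minus_X_power_nth m)
    next
      case (Suc e')
      then have "m - d = d * e'" "\<not> m < d" by (simp_all add: m)
      then show ?thesis
        by (simp add: fps_mult_one_minus_X_power_nth m B_mult Suc del: mult_Suc_right)
    qed
  next
    case False
    then have "\<not> d dvd m - d" if "\<not> m < d"
      using that by (simp add: dvd_minus_self)
    with False show ?thesis
      by (simp add: fps_mult_one_minus_X_power_nth B_other)
  qed
  then have "B (Suc c) * (1 - fps_X ^ d) = B c" by (rule fps_ext)
  then have "B (Suc c) * (1 - fps_X ^ d) ^ Suc c = B c * (1 - fps_X ^ d) ^ c"
    by (simp only: power_Suc mult.assoc[symmetric])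
  with Suc show ?case by (simp only: B_def)
qed

section \<open>Partitions in a box with total in a residue class\<close>

lemma fps_mult_one_minus_const_X_nth:
  fixes F :: "'a :: comm_ring_1 fps"
  shows "fps_nth (F * (1 - fps_const c * fps_X)) m =
    fps_nth F m - (if m = 0 then 0 else c * fps_nth F (m - 1))"
proof -
  have "F * (1 - fps_const c * fps_X) = F - fps_const c * (F * fps_X)"
    by (simp add: algebra_simps)
  then show ?thesis by simp
qed

text \<open>The series variable marks the bound on the number of parts. For \<open>b = 0\<close> all
  coefficients are 1, which gives the factor \<open>j = 0\<close>; each further factor is the
  q-Pascal rule solved for the smaller box.\<close>

lemma box_gf_fps:
  fixes x :: "'a :: comm_ring_1"
  shows "Abs_fps (\<lambda>a. box_gf a b x) * (\<Prod>j\<le>b. 1 - fps_const (x ^ j) * fps_X) = 1"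
proof (induction b)
  case 0
  have "Abs_fps (\<lambda>_. 1) * (1 - fps_const 1 * fps_X) = (1 :: 'a fps)"
    by (rule fps_ext) (simp only: fps_mult_one_minus_const_X_nth, simp)
  then show ?case by simp
next
  case (Suc b)
  have "fps_nth (Abs_fps (\<lambda>a. box_gf a (Suc b) x) * (1 - fps_const (x ^ Suc b) * fps_X)) a =
      fps_nth (Abs_fps (\<lambda>a. box_gf a b x)) a" for a
    unfolding fps_mult_one_minus_const_X_nth by (cases a) (simp_all add: box_gf_Suc_Suc)
  then have "Abs_fps (\<lambda>a. box_gf a (Suc b) x) * (1 - fps_const (x ^ Suc b) * fps_X) = Abs_fps (\<lambda>a. box_gf a b x)"
    by (rule fps_ext)
  then have "Abs_fps (\<lambda>a. box_gf a (Suc b) x) * ((1 - fps_const (x ^ Suc b) * fps_X) *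
      (\<Prod>j\<le>b. 1 - fps_const (x ^ j) * fps_X)) = 1"
    using Suc by (simp only: mult.assoc[symmetric])
  then show ?case by (simp only: prod.atMost_Suc mult.commute)
qed

text \<open>Uniqueness of inverses, used to compare two series with the same denominator.\<close>

lemma eq_if_mult_eq_1:
  fixes a b c :: "'a :: comm_monoid_mult"
  assumes "a * c = 1" "b * c = 1"
  shows "a = b"
proof -
  have "a = a * (b * c)" by (simp add: assms)
  also have "\<dots> = (a * c) * b" by (simp only: ac_simps)
  finally show ?thesis by (simp add: assms)
qed

text \<open>The exponents from 0 to \<open>d * c - 1\<close> run through \<open>c\<close> full
  periods of \<open>z\<close>, so the denominator collapses to \<open>(1 - X^d)^c\<close>.\<close>

lemma box_gf_primitive_root:
  fixes z :: complex
  assumes "d > 0" "c > 0" and z: "\<And>i. z ^ i = 1 \<longleftrightarrow> d dvd i"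
  shows "box_gf m (d * c - 1) z =
    (if d dvd m then of_nat ((c + m div d - 1) choose (m div d)) else 0)"
proof -
  have fps: "1 - fps_const (z ^ j) * fps_X = fps_of_poly [:1, - (z ^ j):]" for j
    by (simp add: fps_of_poly_linear' flip: fps_const_neg)
  have "{..d * c - 1} = {..<d * c}"
    using assms lessThan_Suc_atMost[of "d * c - 1"] by simp
  then have "(\<Prod>j\<le>d * c - 1. 1 - fps_const (z ^ j) * fps_X) =
      fps_of_poly (\<Prod>j<d * c. [:1, - (z ^ j):])"
    by (simp add: fps fps_of_poly_prod)
  also have "(\<Prod>j<d * c. [:1, - (z ^ j):]) = (1 - monom 1 d) ^ c"
    using z[of d] by (subst prod_periodic) (simp_all add: power_add prod_one_minus_root_powers[OF assms(1) z])
  also have "fps_of_poly \<dots> = (1 - fps_X ^ d) ^ c"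
    by (simp add: fps_of_poly_power fps_of_poly_diff fps_of_poly_monom')
  finally have "Abs_fps (\<lambda>m. box_gf m (d * c - 1) z) * (1 - fps_X ^ d) ^ c = 1"
    using box_gf_fps[of "d * c - 1" z] by simp
  then have "Abs_fps (\<lambda>m. box_gf m (d * c - 1) z) =
      Abs_fps (\<lambda>m. if d dvd m then of_nat ((c + m div d - 1) choose (m div d)) else 0)"
    by (rule eq_if_mult_eq_1) (rule multichoose_fps[OF assms(1)])
  then show ?thesis by (simp add: fps_eq_iff)
qed

text \<open>As \<open>j\<close> is coprime to \<open>d\<close>, this root is primitive of order
  \<open>d\<close>. The negative sign is the one with which the total enters the congruence
  test.\<close>

lemma box_gf_unity_root:
  assumes "n > 0" "d dvd n" "j \<in> totatives d"
  shows "box_gf m (n - 1) (unity_root d (- int j)) =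
    (if d dvd m then of_nat (((n + m - d) div d) choose (m div d)) else 0)"
proof -
  obtain c where n: "n = d * c" using assms(2) ..
  have pos: "d > 0" "c > 0" using assms(1) n by auto
  have "unity_root d (- int j) ^ i = 1 \<longleftrightarrow> d dvd i" for i
  proof -
    have "unity_root d (- int j) ^ i = 1 \<longleftrightarrow> int d dvd int (i * j)"
      using pos by (simp add: unity_root_power unity_root_eq_1_iff)
    also have "\<dots> \<longleftrightarrow> d dvd i"
      using assms(3) unfolding int_dvd_int_iff
      by (simp add: totatives_def coprime_dvd_mult_left_iff coprime_commute)
    finally show ?thesis .
  qed
  note * = box_gf_primitive_root[OF pos this, of m]
  have "(n + m - d) div d = c + m div d - 1" if dm: "d dvd m"
  proof -
    obtain e where "m = d * e" using dm by (rule dvdE)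
    then have "n + m - d = d * (c + e - 1)"
      using pos by (simp add: n algebra_simps)
    then show ?thesis using pos \<open>m = d * e\<close> by simp
  qed
  with * show ?thesis by (simp add: n)
qed

text \<open>The roots-of-unity filter: \<open>n\<close> times the indicator of the congruence is a
  full sum over \<open>n\<close>-th roots of unity.\<close>

lemma card_partitions_in_box_cong:
  assumes "n > 0"
  shows "of_nat n * of_nat (card {p \<in> partitions_in_box (int m) (int (n - 1)).
            [int (sum_mset p) = N] (mod int n)}) =
    (\<Sum>d | d dvd n \<and> d dvd m.
       of_nat (((n + m - d) div d) choose (m div d)) * ramanujan_sum d N)"
proof -
  let ?B = "partitions_in_box (int m) (int (n - 1))"
  have "of_nat n * of_nat (card {p \<in> ?B. [int (sum_mset p) = N] (mod int n)}) =
      (\<Sum>p\<in>?B. if [int (sum_mset p) = N] (mod int n) then of_nat n else (0 :: complex))"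
    by (simp add: finite_partitions_in_box mult.commute flip: sum.inter_filter)
  also have "\<dots> = (\<Sum>p\<in>?B. \<Sum>j\<in>{0<..n}. unity_root n (int j * (N - int (sum_mset p))))"
    by (simp add: sum_unity_root[OF assms] cong_iff_dvd_diff dvd_diff_commute)
  also have "\<dots> = (\<Sum>j\<in>{0<..n}. \<Sum>p\<in>?B. unity_root n (int j * (N - int (sum_mset p))))"
    by (rule sum.swap)
  also have "\<dots> = (\<Sum>d | d dvd n. \<Sum>j\<in>totatives d. \<Sum>p\<in>?B. unity_root d (int j * (N - int (sum_mset p))))"
    by (rule sum_unity_root_by_order[OF assms, where f = "\<lambda>g. \<Sum>p\<in>?B. g (N - int (sum_mset p))"])
  also have "\<dots> = (\<Sum>d | d dvd n. if d dvd m then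
      of_nat (((n + m - d) div d) choose (m div d)) * ramanujan_sum d N else 0)"
  proof (rule sum.cong[OF refl])
    fix d assume d: "d \<in> {d. d dvd n}"
    \<comment> \<open>The total enters only as an exponent, so the box contributes its generating
      function at a primitive root. That value is the same for all totatives \<open>j\<close>, and
      the remaining factors add up to \<open>ramanujan_sum d N\<close>.\<close>
    have inner: "(\<Sum>p\<in>?B. unity_root d (int j * (N - int (sum_mset p)))) =
        unity_root d (int j * N) * box_gf m (n - 1) (unity_root d (- int j))" for j
    proof -
      have "unity_root d (int j * (N - int s)) = unity_root d (int j * N) * unity_root d (- int j) ^ s" for s
        by (simp add: unity_root_power algebra_simps flip: unity_root_add)
      then show ?thesis by (simp only: box_gf_def sum_distrib_left)
    qed
    have "(\<Sum>j\<in>totatives d. \<Sum>p\<in>?B. unity_root d (int j * (N - int (sum_mset p)))) =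
        (\<Sum>j\<in>totatives d. unity_root d (int j * N) *
          (if d dvd m then of_nat (((n + m - d) div d) choose (m div d)) else 0))"
      using d by (intro sum.cong refl) (simp only: inner box_gf_unity_root[OF assms] mem_Collect_eq)
    then show "(\<Sum>j\<in>totatives d. \<Sum>p\<in>?B. unity_root d (int j * (N - int (sum_mset p)))) =
        (if d dvd m then of_nat (((n + m - d) div d) choose (m div d)) * ramanujan_sum d N else 0)"
      by (simp add: ramanujan_sum_eq sum_distrib_right[symmetric] mult.commute)
  qed
  also have "\<dots> = (\<Sum>d | d dvd n \<and> d dvd m.
       of_nat (((n + m - d) div d) choose (m div d)) * ramanujan_sum d N)"
    using assms by (simp flip: sum.inter_filter)
  finally show ?thesis .
qed

section \<open>Assembling the four formulas\<close>

theorem theorem2: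
  fixes n k :: nat and w :: "nat \<Rightarrow> nat"
  assumes "n \<ge> 2" and "k \<ge> 1" and "w permutes {1..n}"
  shows
    "affine_shuffle_coeff n k w =
       1 / real k ^ (n - 1) *
       real (card {p \<in> partitions_in_box (int (n - 1)) (int k - int (cd n w)).
                     [int (sum_mset p) = - int (maj n w)] (mod int n)}) \<and>
     affine_shuffle_coeff n k w =
       1 / real k ^ (n - 1) *
       real (card {p \<in> partitions_in_box (int k - int (cd n w)) (int (n - 1)).
                     [int (sum_mset p) = - int (maj n w)] (mod int n)}) \<and>
     affine_shuffle_coeff n k w =
       1 / real k ^ (n - 1) *
       (\<Sum>r. coeff (monom 1 (maj n w) *
                     q_binomial (int k + int n - int (cd n w) - 1) (n - 1)) (r * n)) \<and>
     complex_of_real (affine_shuffle_coeff n k w) =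
       (if int k - int (cd n w) > 0 then
          1 / (of_nat n * of_nat k ^ (n - 1)) *
          (\<Sum>d | d dvd n \<and> d dvd (k - cd n w).
             of_nat (((n + (k - cd n w) - d) div d) choose ((k - cd n w) div d)) *
             ramanujan_sum d (- int (maj n w)))
        else if int k - int (cd n w) = 0 \<and> [maj n w = 0] (mod n) then
          1 / of_nat k ^ (n - 1)
        else 0)"
proof -
  define K where "K = int k - int (cd n w)"
  define M where "M = maj n w"
  \<comment> \<open>The count in (2), to which the other three formulas are reduced.\<close>
  define C where "C = card {p \<in> partitions_in_box K (int (n - 1)). [int (sum_mset p) = - int M] (mod int n)}"
  have n: "n > 0" using assms(1) by simp
  have coeff_C: "affine_shuffle_coeff n k w = 1 / real k ^ (n - 1) * real C"
    using card_affine_shuffle_vectors[of n k w] n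
    by (simp add: affine_shuffle_coeff_def C_def K_def M_def)
  have conj: "card {p \<in> partitions_in_box (int (n - 1)) K. [int (sum_mset p) = - int M] (mod int n)} = C"
    unfolding C_def by (rule card_partitions_in_box_commute)
  have neg: "C = 0" if "K < 0"
    using that by (simp add: C_def partitions_in_box_negative)
  have cong_iff: "[int s = - int M] (mod int n) \<longleftrightarrow> n dvd M + s" for s
    by (simp add: cong_iff_dvd_diff add.commute flip: of_nat_add)
  have gf: "(\<Sum>r. coeff (monom 1 M * q_binomial (K + int n - 1) (n - 1)) (r * n)) = real C"
  proof (cases "K < 0")
    case True
    \<comment> \<open>The upper index lies below \<open>n - 1\<close>, so the q-binomial is zero by
      definition, in accordance with an empty box.\<close>
    then show ?thesis using n by (simp add: q_binomial_def neg)
  next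
    case False
    then obtain a where a: "K = int a" by (metis nonneg_int_cases not_less)
    have "K + int n - 1 = int (a + (n - 1))" using a n by simp
    then have "q_binomial (K + int n - 1) (n - 1) = box_gf a (n - 1) (monom 1 1)"
      by (simp only: q_binomial_eq_box_gf)
    then show ?thesis
      by (simp only: suminf_coeff_box_gf[OF n] C_def cong_iff a)
  qed
  have root_sum: "complex_of_real (affine_shuffle_coeff n k w) =
      (if K > 0 then
          1 / (of_nat n * of_nat k ^ (n - 1)) *
          (\<Sum>d | d dvd n \<and> d dvd (k - cd n w).
             of_nat (((n + (k - cd n w) - d) div d) choose ((k - cd n w) div d)) *
             ramanujan_sum d (- int M))
        else if K = 0 \<and> [M = 0] (mod n) then 1 / of_nat k ^ (n - 1) else 0)"
  proof -
    consider "K > 0" | "K = 0" | "K < 0" by linarith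
    then show ?thesis
    proof cases
      case 1
      \<comment> \<open>Positivity makes the truncated subtraction \<open>k - cd n w\<close> the
        true difference.\<close>
      then have "K = int (k - cd n w)" by (simp add: K_def)
      then have "(\<Sum>d | d dvd n \<and> d dvd (k - cd n w).
             of_nat (((n + (k - cd n w) - d) div d) choose ((k - cd n w) div d)) *
             ramanujan_sum d (- int M)) = of_nat n * of_nat C"
        using card_partitions_in_box_cong[OF n, of "k - cd n w" "- int M"] by (simp add: C_def)
      then show ?thesis using 1 n by (simp add: coeff_C)
    next
      case 2
      \<comment> \<open>Only the empty partition fits, so the congruence becomes a condition on
        \<open>M\<close> alone.\<close>
      have "{p \<in> partitions_in_box 0 (int (n - 1)). n dvd M + sum_mset p} =
          (if n dvd M then {{#}} else {})"
        unfolding partitions_in_box_0_left by auto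
      then have "C = (if [M = 0] (mod n) then 1 else 0)"
        unfolding C_def 2 cong_iff by (simp add: cong_0_iff)
      then show ?thesis using 2 by (simp add: coeff_C)
    next
      case 3
      then show ?thesis by (simp add: coeff_C neg)
    qed
  qed
  have "int k + int n - int (cd n w) - 1 = K + int n - 1"
    by (simp add: K_def)
  then show ?thesis
    unfolding K_def[symmetric] M_def[symmetric] C_def[symmetric] conj
    using coeff_C root_sum by (simp only: gf simp_thms)
qed

end
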